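(* Consider an instance of risk-averse budgeted set cover as described in the context. Let $\big(x,\{(y_A,z_A,r_A)\}_A\big)$ be a solution satisfying constraints (2)–(5) of (RASC-P), with objective value $C=w^{\mathrm{I}}\cdot x+\sum_Ap_Aw^A\cdot(y_A+z_A)$, and let $P=\sum_Ap_Ar_A$. Then for any $\varepsilon>0$ one can obtain: (i) a solution $\hat x\in\mathbb R^m_{\ge0}$ such that $w^{\mathrm{I}}\cdot\hat x+\sum_Ap_Af_A(\hat x)\le(1+\frac1\varepsilon)C$ and $\Pr_A\big[f_A(\hat x)>(1+\frac1\varepsilon)B\big]\le(1+\varepsilon)P$; (ii) using an LP-based $c$-approximation algorithm for the deterministic set cover problem, an integer solution $(\tilde x,\{\tilde y_A\})$ of cost at most $2c(1+\frac1\varepsilon)C$ such that $\Pr_A\big[w^A\cdot\tilde y_A>2cB(1+\frac1\varepsilon)\big]\le(1+\varepsilon)P$. Moreover, only the first-stage component $x$ is needed in order to obtain $\hat x$ and $\tilde x$.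
   Context: Risk-averse budgeted set cover: a universe $U$ of $n$ elements and a collection $\mathcal S$ of $m$ subsets of $U$ are given. A probability distribution $\{p_A\}_{A\in\mathcal A}$ over scenarios is given, where each scenario $A\subseteq U$ is a set of elements that must be covered. Picking a set $S$ in the first stage costs $w^{\mathrm{I}}_S\ge 0$, and in scenario $A$ costs $w^A_S\ge 0$. A budget $B\ge 0$ and threshold $\rho\in[0,1]$ are given. For $x\in\mathbb R^m_{\ge 0}$, $f_A(x)=\min\{w^A\cdot y: y\in\mathbb R^m_{\ge0},\ \sum_{S:e\in S}y_S\ge 1-\sum_{S:e\in S}x_S\ \forall e\in A\}$. The constraints of the LP (RASC-P) are: (1) $\sum_Ap_Ar_A\le\rho$; (2) $\sum_{S:e\in S}(x_S+y_{A,S})+r_A\ge 1$ for all $A$, $e\in A$; (3) $\sum_{S:e\in S}(x_S+y_{A,S}+z_{A,S})\ge1$ for all $A$, $e\in A$; (4) $\sum_S w^A_Sy_{A,S}\le B$ for all $A$; (5) $x_S,y_{A,S},z_{A,S},r_A\ge0$. An integer solution consists of $\tilde x\in\{0,1\}^m$ and $\tilde y_A\in\{0,1\}^m$ for every scenario $A$ such that every element of $A$ lies in some set $S$ with $\tilde x_S=1$ or $\tilde y_{A,S}=1$; its cost is $w^{\mathrm{I}}\cdot\tilde x+\sum_Ap_Aw^A\cdot\tilde y_A$. An LP-based $c$-approximation algorithm for deterministic set cover is one that returns a set cover of cost at most $c$ times the optimum of the standard LP relaxation of set cover. *)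

theory Defs
  imports "HOL-Probability.Probability"
begin

text \<open>
  The set system is an indexed family: \<open>I\<close> is the finite set of indices and \<open>F S\<close>, for \<open>S \<in> I\<close>, is a
  set of elements.  Repeated sets are allowed; a plain collection of sets is the case
  \<open>F = (\<lambda>S. S)\<close>.  A vector in \<open>\<real>\<^sup>m\<close> is a function whose values on \<open>I\<close> are the only relevant ones.
\<close>

definition dot :: "'s set \<Rightarrow> ('s \<Rightarrow> real) \<Rightarrow> ('s \<Rightarrow> real) \<Rightarrow> real" where
  "dot I w x = (\<Sum>S\<in>I. w S * x S)"

definition coverage :: "'s set \<Rightarrow> ('s \<Rightarrow> 'a set) \<Rightarrow> ('s \<Rightarrow> real) \<Rightarrow> 'a \<Rightarrow> real" where
  "coverage I F x e = (\<Sum>S\<in>{S\<in>I. e \<in> F S}. x S)"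

definition covering_feasible ::
    "'s set \<Rightarrow> ('s \<Rightarrow> 'a set) \<Rightarrow> 'a set \<Rightarrow> ('a \<Rightarrow> real) \<Rightarrow> ('s \<Rightarrow> real) set" where
  "covering_feasible I F E d =
     {y. (\<forall>S\<in>I. 0 \<le> y S) \<and> (\<forall>e\<in>E. coverage I F y e \<ge> d e)}"

text \<open>
  The minimum of a covering LP is written as an infimum; lemma \<open>covering_opt_attained\<close> shows that
  it is attained whenever the LP is feasible, the costs are nonnegative and the demands are at
  most 1, as is the case for both LPs below (given \<open>x \<ge> 0\<close> in the recourse LP).
\<close>

definition covering_opt ::
    "'s set \<Rightarrow> ('s \<Rightarrow> 'a set) \<Rightarrow> 'a set \<Rightarrow> ('a \<Rightarrow> real) \<Rightarrow> ('s \<Rightarrow> real) \<Rightarrow> real" where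
  "covering_opt I F E d w = (INF y\<in>covering_feasible I F E d. dot I w y)"

text \<open>The standard LP relaxation of the set cover problem of covering \<open>E\<close>.\<close>

definition set_cover_lp_opt ::
    "'s set \<Rightarrow> ('s \<Rightarrow> 'a set) \<Rightarrow> 'a set \<Rightarrow> ('s \<Rightarrow> real) \<Rightarrow> real" where
  "set_cover_lp_opt I F E w = covering_opt I F E (\<lambda>_. 1) w"

text \<open>The recourse cost \<open>f\<^sub>A(x)\<close>, with \<open>w\<close> the cost vector of scenario \<open>A\<close>.\<close>

definition recourse ::
    "'s set \<Rightarrow> ('s \<Rightarrow> 'a set) \<Rightarrow> ('s \<Rightarrow> real) \<Rightarrow> 'a set \<Rightarrow> ('s \<Rightarrow> real) \<Rightarrow> real" where
  "recourse I F w A x = covering_opt I F A (\<lambda>e. 1 - coverage I F x e) w"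

text \<open>
  An algorithm is modelled by its input-output function: \<open>alg I F E w\<close> is the index set of the
  sets it picks on the set cover instance with universe \<open>E\<close>, family \<open>F\<close> over \<open>I\<close>, and costs \<open>w\<close>.
  Only instances that have a set cover are constrained.
\<close>

definition lp_based_set_cover_alg ::
    "real \<Rightarrow> ('s set \<Rightarrow> ('s \<Rightarrow> 'a set) \<Rightarrow> 'a set \<Rightarrow> ('s \<Rightarrow> real) \<Rightarrow> 's set) \<Rightarrow> bool" where
  "lp_based_set_cover_alg c alg \<longleftrightarrow>
     (\<forall>I F E w. finite I \<and> finite E \<and> (\<forall>S\<in>I. F S \<subseteq> E) \<and> E \<subseteq> (\<Union>S\<in>I. F S) \<and> (\<forall>S\<in>I. 0 \<le> w S)
        \<longrightarrow> alg I F E w \<subseteq> I \<and> E \<subseteq> (\<Union>S\<in>alg I F E w. F S)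
            \<and> (\<Sum>S\<in>alg I F E w. w S) \<le> c * set_cover_lp_opt I F E w)"

text \<open>
  \<open>\<A>\<close> is the set of scenarios, \<open>wI\<close> the first-stage costs and \<open>wII A\<close> the costs in scenario \<open>A\<close>.
  Scenarios of probability 0 are permitted in \<open>\<A>\<close>.
\<close>

locale rasc_instance =
  fixes U :: "'a set" and I :: "'s set" and F :: "'s \<Rightarrow> 'a set"
    and \<A> :: "'a set set" and p :: "'a set pmf"
    and wI :: "'s \<Rightarrow> real" and wII :: "'a set \<Rightarrow> 's \<Rightarrow> real"
    and B :: real and \<rho> :: real
  assumes finite_universe: "finite U"
    and finite_index: "finite I"
    and sets_subset: "\<And>S. S \<in> I \<Longrightarrow> F S \<subseteq> U"
    and scenario_subset: "\<And>A. A \<in> \<A> \<Longrightarrow> A \<subseteq> U"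
    and distribution: "set_pmf p \<subseteq> \<A>"
    and wI_nonneg: "\<And>S. S \<in> I \<Longrightarrow> 0 \<le> wI S"
    and wII_nonneg: "\<And>A S. A \<in> \<A> \<Longrightarrow> S \<in> I \<Longrightarrow> 0 \<le> wII A S"
    and budget_nonneg: "0 \<le> B"
    and threshold: "0 \<le> \<rho>" "\<rho> \<le> 1"

text \<open>The constraints of (RASC-P) without the probability constraint \<open>(\<Sum>A\<in>\<A>. p\<^sub>A r\<^sub>A) \<le> \<rho>\<close>.\<close>

definition rasc_feasible ::
    "'s set \<Rightarrow> ('s \<Rightarrow> 'a set) \<Rightarrow> 'a set set \<Rightarrow> ('a set \<Rightarrow> 's \<Rightarrow> real) \<Rightarrow> real
     \<Rightarrow> ('s \<Rightarrow> real) \<Rightarrow> ('a set \<Rightarrow> 's \<Rightarrow> real) \<Rightarrow> ('a set \<Rightarrow> 's \<Rightarrow> real) \<Rightarrow> ('a set \<Rightarrow> real) \<Rightarrow> bool" where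
  "rasc_feasible I F \<A> wII B x y z r \<longleftrightarrow>
     (\<forall>A\<in>\<A>. \<forall>e\<in>A. coverage I F (\<lambda>S. x S + y A S) e + r A \<ge> 1) \<and>
     (\<forall>A\<in>\<A>. \<forall>e\<in>A. coverage I F (\<lambda>S. x S + y A S + z A S) e \<ge> 1) \<and>
     (\<forall>A\<in>\<A>. dot I (wII A) (y A) \<le> B) \<and>
     (\<forall>S\<in>I. 0 \<le> x S) \<and>
     (\<forall>A\<in>\<A>. (\<forall>S\<in>I. 0 \<le> y A S \<and> 0 \<le> z A S) \<and> 0 \<le> r A)"

definition rasc_objective ::
    "'s set \<Rightarrow> 'a set set \<Rightarrow> 'a set pmf \<Rightarrow> ('s \<Rightarrow> real) \<Rightarrow> ('a set \<Rightarrow> 's \<Rightarrow> real)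
     \<Rightarrow> ('s \<Rightarrow> real) \<Rightarrow> ('a set \<Rightarrow> 's \<Rightarrow> real) \<Rightarrow> ('a set \<Rightarrow> 's \<Rightarrow> real) \<Rightarrow> real" where
  "rasc_objective I \<A> p wI wII x y z =
     dot I wI x + (\<Sum>A\<in>\<A>. pmf p A * dot I (wII A) (\<lambda>S. y A S + z A S))"

definition integer_solution ::
    "'s set \<Rightarrow> ('s \<Rightarrow> 'a set) \<Rightarrow> 'a set set \<Rightarrow> ('s \<Rightarrow> real) \<Rightarrow> ('a set \<Rightarrow> 's \<Rightarrow> real) \<Rightarrow> bool" where
  "integer_solution I F \<A> x y \<longleftrightarrow>
     (\<forall>S\<in>I. x S \<in> {0, 1}) \<and> (\<forall>A\<in>\<A>. \<forall>S\<in>I. y A S \<in> {0, 1}) \<and>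
     (\<forall>A\<in>\<A>. \<forall>e\<in>A. \<exists>S\<in>I. e \<in> F S \<and> (x S = 1 \<or> y A S = 1))"

definition integer_cost ::
    "'s set \<Rightarrow> 'a set set \<Rightarrow> 'a set pmf \<Rightarrow> ('s \<Rightarrow> real) \<Rightarrow> ('a set \<Rightarrow> 's \<Rightarrow> real)
     \<Rightarrow> ('s \<Rightarrow> real) \<Rightarrow> ('a set \<Rightarrow> 's \<Rightarrow> real) \<Rightarrow> real" where
  "integer_cost I \<A> p wI wII x y =
     dot I wI x + (\<Sum>A\<in>\<A>. pmf p A * dot I (wII A) (y A))"

lemma covering_opt_attained:
  assumes fin: "finite I" and w: "\<And>S. S \<in> I \<Longrightarrow> 0 \<le> w S"
    and d: "\<And>e. e \<in> E \<Longrightarrow> d e \<le> 1"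
    and ne: "covering_feasible I F E d \<noteq> {}"
  shows "\<exists>y\<in>covering_feasible I F E d. dot I w y = covering_opt I F E d w"
proof -
  define K where "K = (\<Pi>\<^sub>E S\<in>UNIV. if S \<in> I then {0..1::real} else {0})"
  define K' where "K' = K \<inter> {y. \<forall>e\<in>E. coverage I F y e \<ge> d e}"
  define tr where "tr y S = (if S \<in> I then min (y S) 1 else (0::real))" for y S
  have tr: "tr y \<in> K'" "dot I w (tr y) \<le> dot I w y" if y: "y \<in> covering_feasible I F E d" for y
  proof -
    have nn: "0 \<le> y S" if "S \<in> I" for S
      using y that by (auto simp: covering_feasible_def)
    have "coverage I F (tr y) e \<ge> d e" if e: "e \<in> E" for e
    proof (cases "\<exists>S\<in>I. e \<in> F S \<and> y S \<ge> 1")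
      case True
      then obtain S where S: "S \<in> I" "e \<in> F S" "y S \<ge> 1" by blast
      have "tr y S \<le> coverage I F (tr y) e"
        unfolding coverage_def using S fin nn
        by (intro member_le_sum) (auto simp: tr_def)
      then show ?thesis using S d[OF e] by (simp add: tr_def)
    next
      case False
      then have "coverage I F (tr y) e = coverage I F y e"
        unfolding coverage_def by (intro sum.cong) (auto simp: tr_def min_def)
      then show ?thesis using y e by (auto simp: covering_feasible_def)
    qed
    then show "tr y \<in> K'"
      using nn by (auto simp: K'_def K_def tr_def)
    show "dot I w (tr y) \<le> dot I w y"
      unfolding dot_def using w by (intro sum_mono mult_left_mono) (auto simp: tr_def)
  qed
  have K'_feas: "K' \<subseteq> covering_feasible I F E d"
    by (fastforce simp: K'_def K_def covering_feasible_def PiE_iff split: if_splits)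
  have "compactin (product_topology (\<lambda>S. euclidean) UNIV) K"
    unfolding K_def by (subst compactin_PiE) auto
  then have "compact K"
    by (simp add: euclidean_product_topology)
  moreover have "closed {y. \<forall>e\<in>E. coverage I F y e \<ge> d e}"
    unfolding coverage_def Ball_def
    by (intro closed_Collect_all closed_Collect_imp open_Collect_const closed_Collect_le
        continuous_intros continuous_on_product_coordinates)
  ultimately have "compact K'"
    unfolding K'_def by (rule compact_Int_closed)
  moreover have "K' \<noteq> {}" using tr ne by blast
  moreover have "continuous_on K' (dot I w)"
    unfolding dot_def
    by (intro continuous_intros continuous_on_subset[OF continuous_on_product_coordinates]) auto
  ultimately obtain y where y: "y \<in> K'" "\<And>v. v \<in> K' \<Longrightarrow> dot I w y \<le> dot I w v"
    using continuous_attains_inf by metis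
  have min: "dot I w y \<le> dot I w v" if "v \<in> covering_feasible I F E d" for v
    using tr[OF that] y(2) by fastforce
  have "covering_opt I F E d w = dot I w y"
    unfolding covering_opt_def
    by (rule cInf_eq_minimum) (use y K'_feas min in auto)
  then show ?thesis using y K'_feas by auto
qed

end

theory Submission
  imports Defs
begin

text \<open>
  Scale by \<open>k = 1 + 1/\<epsilon>\<close> and take \<open>k x\<close> as first stage. In every scenario \<open>k (y\<^sub>A + z\<^sub>A)\<close> is then a
  feasible recourse, which bounds the expected cost. If \<open>r\<^sub>A < 1/(1 + \<epsilon>)\<close>, then \<open>x + y\<^sub>A\<close> covers
  every element of \<open>A\<close> to an extent of at least \<open>1 - r\<^sub>A > 1/k\<close>, so already \<open>k y\<^sub>A\<close> is a feasible
  recourse and its cost is at most \<open>k B\<close>; Markov's inequality bounds the probability of the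
  remaining scenarios. For the integer solution, the first stage covers the elements that \<open>k x\<close>
  covers to an extent of at least \<open>1/2\<close>, and the recourse covers the others: both are set cover
  instances for which doubling the fractional solution is feasible for the standard LP.
\<close>

section \<open>Linearity and sign of costs and coverage\<close>

lemma dot_scale: "dot I w (\<lambda>S. a * y S) = a * dot I w y"
  by (simp add: dot_def sum_distrib_left mult_ac)

lemma dot_nonneg:
  assumes "\<And>S. S \<in> I \<Longrightarrow> 0 \<le> w S" "\<And>S. S \<in> I \<Longrightarrow> 0 \<le> y S"
  shows "0 \<le> dot I w y"
  unfolding dot_def using assms by (intro sum_nonneg mult_nonneg_nonneg) auto

lemma dot_of_bool:
  assumes "finite I" "X \<subseteq> I"
  shows "dot I w (\<lambda>S. of_bool (S \<in> X)) = sum w X"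
proof -
  have "I \<inter> {S. S \<in> X} = X" using assms(2) by blast
  then show ?thesis using assms by (simp add: dot_def)
qed

lemma coverage_scale: "coverage I F (\<lambda>S. a * y S) e = a * coverage I F y e"
  by (simp add: coverage_def sum_distrib_left)

lemma coverage_add: "coverage I F (\<lambda>S. y S + z S) e = coverage I F y e + coverage I F z e"
  by (simp add: coverage_def sum.distrib)

lemma coverage_nonneg:
  assumes "\<And>S. S \<in> I \<Longrightarrow> 0 \<le> y S"
  shows "0 \<le> coverage I F y e"
  unfolding coverage_def using assms by (intro sum_nonneg) auto

lemma coverage_nonzeroD: "coverage I F y e \<noteq> 0 \<Longrightarrow> \<exists>S\<in>I. e \<in> F S"
  unfolding coverage_def by (metis (mono_tags, lifting) mem_Collect_eq sum.neutral)

lemma coverage_restrict: "e \<in> E \<Longrightarrow> coverage I (\<lambda>S. F S \<inter> E) y e = coverage I F y e"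
  by (simp add: coverage_def)

section \<open>Covering LP values and the guarantee of the set cover algorithm\<close>

lemma covering_opt_le:
  assumes "\<And>S. S \<in> I \<Longrightarrow> 0 \<le> w S" "y \<in> covering_feasible I F E d"
  shows "covering_opt I F E d w \<le> dot I w y"
  unfolding covering_opt_def
\<comment> \<open>A real infimum is a lower bound only for sets bounded below; nonnegative costs
  give the bound 0.\<close>
proof (rule cINF_lower[OF bdd_belowI2[where m = 0]])
  show "0 \<le> dot I w v" if "v \<in> covering_feasible I F E d" for v
    using assms(1) that by (intro dot_nonneg) (auto simp: covering_feasible_def)
qed (rule assms(2))

text \<open>The definition of an LP-based algorithm does not restrict the sign of \<open>c\<close>,
  but multiplying inequalities by \<open>c\<close> does. The sign is read off one test instance, a
  single element covered by a single set of unit cost: the algorithm pays a nonnegative amount,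
  while the LP value is at least 1.\<close>

lemma lp_based_set_cover_alg_nonneg_ratio:
  fixes alg :: "'s set \<Rightarrow> ('s \<Rightarrow> 'a set) \<Rightarrow> 'a set \<Rightarrow> ('s \<Rightarrow> real) \<Rightarrow> 's set"
  assumes "lp_based_set_cover_alg c alg"
  shows "0 \<le> c"
proof -
  fix s :: 's and a :: 'a
  define F where "F = (\<lambda>_::'s. {a})"
  define w where "w = (\<lambda>_::'s. 1::real)"
  have "0 \<le> (\<Sum>S\<in>alg {s} F {a} w. w S)"
    by (simp add: w_def)
  also have "\<dots> \<le> c * set_cover_lp_opt {s} F {a} w"
    using assms unfolding lp_based_set_cover_alg_def
    by (metis F_def w_def finite.emptyI finite_insert insertI1 UN_singleton UN_insert UN_empty
        Un_empty_right order_refl zero_le_one)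
  finally have le: "0 \<le> c * set_cover_lp_opt {s} F {a} w" .
  have "{S. S = s \<and> a \<in> F S} = {s}" by (auto simp: F_def)
  then have cov: "coverage {s} F y a = y s" for y
    by (simp add: coverage_def)
  have "1 \<le> set_cover_lp_opt {s} F {a} w"
    unfolding set_cover_lp_opt_def covering_opt_def
  proof (rule cINF_greatest)
    have "(\<lambda>_. 1) \<in> covering_feasible {s} F {a} (\<lambda>_. 1)"
      by (simp add: covering_feasible_def cov)
    then show "covering_feasible {s} F {a} (\<lambda>_. 1) \<noteq> {}" by blast
    show "1 \<le> dot {s} w y" if "y \<in> covering_feasible {s} F {a} (\<lambda>_. 1)" for y
      using that by (simp add: covering_feasible_def cov dot_def w_def)
  qed
  with le show ?thesis by (simp add: zero_le_mult_iff)
qed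

text \<open>Twice a vector that covers \<open>E\<close> halfway is feasible for the LP, hence the
  factor 2. The sets are cut down to \<open>E\<close> because the guarantee speaks only of families
  inside the universe; this changes no coverage on \<open>E\<close>.\<close>

lemma lp_based_set_cover_alg_half_covered:
  assumes alg: "lp_based_set_cover_alg c alg" and fin: "finite I" "finite E"
    and w: "\<And>S. S \<in> I \<Longrightarrow> 0 \<le> w S" and y: "\<And>S. S \<in> I \<Longrightarrow> 0 \<le> y S"
    and cov: "\<And>e. e \<in> E \<Longrightarrow> 1 / 2 \<le> coverage I F y e"
  defines "X \<equiv> alg I (\<lambda>S. F S \<inter> E) E w"
  shows "X \<subseteq> I" "E \<subseteq> (\<Union>S\<in>X. F S)" "sum w X \<le> 2 * c * dot I w y"
proof -
  have "E \<subseteq> (\<Union>S\<in>I. F S \<inter> E)"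
  proof
    \<comment> \<open>The guarantee also presupposes that a set cover exists: positive coverage
      means that some set contains \<open>e\<close>.\<close>
    fix e assume e: "e \<in> E"
    then have "coverage I F y e \<noteq> 0" using cov[OF e] by auto
    from coverage_nonzeroD[OF this] e show "e \<in> (\<Union>S\<in>I. F S \<inter> E)" by blast
  qed
  then have *: "X \<subseteq> I \<and> E \<subseteq> (\<Union>S\<in>X. F S \<inter> E)
      \<and> sum w X \<le> c * set_cover_lp_opt I (\<lambda>S. F S \<inter> E) E w"
    using alg[unfolded lp_based_set_cover_alg_def, rule_format, of I E "\<lambda>S. F S \<inter> E" w] fin w
    unfolding X_def by blast
  then show "X \<subseteq> I" "E \<subseteq> (\<Union>S\<in>X. F S)" by auto
  have "(\<lambda>S. 2 * y S) \<in> covering_feasible I (\<lambda>S. F S \<inter> E) E (\<lambda>_. 1)"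
    using y cov by (force simp: covering_feasible_def coverage_restrict coverage_scale)
  then have "set_cover_lp_opt I (\<lambda>S. F S \<inter> E) E w \<le> dot I w (\<lambda>S. 2 * y S)"
    unfolding set_cover_lp_opt_def by (intro covering_opt_le w)
  then have "c * set_cover_lp_opt I (\<lambda>S. F S \<inter> E) E w \<le> c * (2 * dot I w y)"
    using lp_based_set_cover_alg_nonneg_ratio[OF alg] by (simp add: dot_scale mult_left_mono)
  with * show "sum w X \<le> 2 * c * dot I w y" by simp
qed

section \<open>Scaling the first stage\<close>

context rasc_instance
begin

lemma finite_scenarios: "finite \<A>"
  using finite_universe scenario_subset by (meson PowI finite_Pow_iff finite_subset subsetI)

text \<open>Markov's inequality: on \<open>T\<close> the weight \<open>a * r A\<close> dominates the
  indicator, and extending the sum to all scenarios adds nonnegative terms.\<close>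

lemma markov_scenarios:
  assumes "\<And>A. A \<in> \<A> \<Longrightarrow> 0 \<le> r A" "0 \<le> a" "T \<subseteq> \<A>" "\<And>A. A \<in> T \<Longrightarrow> 1 \<le> a * r A"
  shows "measure_pmf.prob p T \<le> a * (\<Sum>A\<in>\<A>. pmf p A * r A)"
proof -
  have "measure_pmf.prob p T = (\<Sum>A\<in>T. pmf p A)"
    using finite_scenarios assms(3) by (intro measure_measure_pmf_finite) (rule finite_subset)
  also have "\<dots> \<le> (\<Sum>A\<in>T. pmf p A * (a * r A))"
    using assms(4) by (intro sum_mono) (simp add: mult_le_cancel_left1)
  also have "\<dots> \<le> (\<Sum>A\<in>\<A>. pmf p A * (a * r A))"
    using assms finite_scenarios by (intro sum_mono2) auto
  finally show ?thesis by (simp add: sum_distrib_left mult_ac)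
qed

text \<open>Constraint (3) is multiplied by \<open>k\<close>, whose value at least 1 keeps the
  right-hand side at least 1. Besides bounding the cost, this shows that the recourse LP is
  feasible, as the rounding requires.\<close>

lemma recourse_feasible_total:
  assumes "rasc_feasible I F \<A> wII B x y z r" "1 \<le> k" "A \<in> \<A>"
  shows "(\<lambda>S. k * (y A S + z A S))
    \<in> covering_feasible I F A (\<lambda>e. 1 - coverage I F (\<lambda>S. k * x S) e)"
proof -
  have "1 - k * coverage I F x e \<le> k * (coverage I F (y A) e + coverage I F (z A) e)"
    if "e \<in> A" for e
  proof -
    have "1 \<le> coverage I F x e + coverage I F (y A) e + coverage I F (z A) e"
      using assms that by (auto simp: rasc_feasible_def coverage_add)
    then have "k * 1 \<le> k * (coverage I F x e + coverage I F (y A) e + coverage I F (z A) e)"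
      using assms(2) by (intro mult_left_mono) auto
    then show ?thesis using assms(2) by (simp add: algebra_simps)
  qed
  then show ?thesis
    using assms by (auto simp: covering_feasible_def coverage_scale coverage_add rasc_feasible_def)
qed

lemma recourse_le_total:
  assumes "rasc_feasible I F \<A> wII B x y z r" "1 \<le> k" "A \<in> \<A>"
  shows "recourse I F (wII A) A (\<lambda>S. k * x S) \<le> k * dot I (wII A) (\<lambda>S. y A S + z A S)"
  using covering_opt_le[OF wII_nonneg recourse_feasible_total] assms
  by (simp add: recourse_def dot_scale)

text \<open>Scaling constraint (2) instead of (3) removes \<open>z\<close>, so only
  \<open>y A\<close>, whose cost the budget limits, is charged.\<close>

lemma recourse_le_budget:
  assumes feas: "rasc_feasible I F \<A> wII B x y z r" and k: "0 \<le> k" and A: "A \<in> \<A>"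
    and r: "1 \<le> k * (1 - r A)"
  shows "recourse I F (wII A) A (\<lambda>S. k * x S) \<le> k * B"
proof -
  have "1 - k * coverage I F x e \<le> k * coverage I F (y A) e" if "e \<in> A" for e
  proof -
    have "1 - r A \<le> coverage I F x e + coverage I F (y A) e"
      using feas A that by (force simp: rasc_feasible_def coverage_add)
    then have "k * (1 - r A) \<le> k * (coverage I F x e + coverage I F (y A) e)"
      using k by (intro mult_left_mono)
    then show ?thesis using r by (simp add: algebra_simps)
  qed
  then have "(\<lambda>S. k * y A S)
      \<in> covering_feasible I F A (\<lambda>e. 1 - coverage I F (\<lambda>S. k * x S) e)"
    using feas k A by (auto simp: covering_feasible_def coverage_scale rasc_feasible_def)
  then have "recourse I F (wII A) A (\<lambda>S. k * x S) \<le> k * dot I (wII A) (y A)"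
    using covering_opt_le[OF wII_nonneg] A by (fastforce simp: recourse_def dot_scale)
  also have "\<dots> \<le> k * B"
    using feas k A by (intro mult_left_mono) (auto simp: rasc_feasible_def)
  finally show ?thesis .
qed

lemma scaled_expected_cost_le:
  assumes "rasc_feasible I F \<A> wII B x y z r" "1 \<le> k"
  shows "dot I wI (\<lambda>S. k * x S) + (\<Sum>A\<in>\<A>. pmf p A * recourse I F (wII A) A (\<lambda>S. k * x S))
    \<le> k * rasc_objective I \<A> p wI wII x y z"
proof -
  have "(\<Sum>A\<in>\<A>. pmf p A * recourse I F (wII A) A (\<lambda>S. k * x S))
      \<le> (\<Sum>A\<in>\<A>. pmf p A * (k * dot I (wII A) (\<lambda>S. y A S + z A S)))"
    using recourse_le_total[OF assms] by (intro sum_mono mult_left_mono) auto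
  also have "\<dots> = k * (\<Sum>A\<in>\<A>. pmf p A * dot I (wII A) (\<lambda>S. y A S + z A S))"
    by (simp add: sum_distrib_left mult_ac)
  finally show ?thesis by (simp add: rasc_objective_def dot_scale algebra_simps)
qed

text \<open>\<open>T\<close> may be any subset of the scenarios over budget, so that the bound
  carries over to the smaller set arising from the integer solution.\<close>

lemma scaled_over_budget_prob_le:
  assumes feas: "rasc_feasible I F \<A> wII B x y z r" and "0 < \<epsilon>"
    and T: "T \<subseteq> {A\<in>\<A>. recourse I F (wII A) A (\<lambda>S. (1 + 1 / \<epsilon>) * x S) > (1 + 1 / \<epsilon>) * B}"
  shows "measure_pmf.prob p T \<le> (1 + \<epsilon>) * (\<Sum>A\<in>\<A>. pmf p A * r A)"
proof (rule markov_scenarios)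
  show "1 \<le> (1 + \<epsilon>) * r A" if "A \<in> T" for A
  proof (rule ccontr)
    assume "\<not> ?thesis"
    \<comment> \<open>From \<open>(1 + \<epsilon>) * r A < 1\<close> it follows that
      \<open>1 - r A > \<epsilon> / (1 + \<epsilon>)\<close>, the reciprocal of
      \<open>1 + 1 / \<epsilon>\<close>.\<close>
    then have "1 \<le> (1 + 1 / \<epsilon>) * (1 - r A)"
      using \<open>0 < \<epsilon>\<close> by (simp add: field_simps)
    then have "recourse I F (wII A) A (\<lambda>S. (1 + 1 / \<epsilon>) * x S) \<le> (1 + 1 / \<epsilon>) * B"
      using feas \<open>0 < \<epsilon>\<close> that T by (intro recourse_le_budget) auto
    then show False using that T by auto
  qed
qed (use assms in \<open>auto simp: rasc_feasible_def\<close>)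

section \<open>Rounding to an integer solution\<close>

lemma rounded_recourse:
  assumes alg: "lp_based_set_cover_alg c alg" and v: "\<And>S. S \<in> I \<Longrightarrow> 0 \<le> v S" and A: "A \<in> \<A>"
    and ne: "covering_feasible I F A (\<lambda>e. 1 - coverage I F v e) \<noteq> {}"
  defines "E \<equiv> {e\<in>A. coverage I F v e < 1 / 2}"
  defines "Y \<equiv> alg I (\<lambda>S. F S \<inter> E) E (wII A)"
  shows "Y \<subseteq> I" "E \<subseteq> (\<Union>S\<in>Y. F S)" "sum (wII A) Y \<le> 2 * c * recourse I F (wII A) A v"
proof -
  \<comment> \<open>Attainment gives a recourse vector whose cost equals the LP value. Its demands
    are at most 1 because \<open>v\<close> has nonnegative coverage.\<close>
  obtain y where y: "y \<in> covering_feasible I F A (\<lambda>e. 1 - coverage I F v e)"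
      "dot I (wII A) y = recourse I F (wII A) A v"
    unfolding recourse_def
    using covering_opt_attained[where w = "wII A", OF finite_index wII_nonneg[OF A] _ ne]
      coverage_nonneg[where F = F, OF v]
    by auto
  have "finite E"
    unfolding E_def using A finite_universe scenario_subset finite_subset by fastforce
  \<comment> \<open>Where \<open>v\<close> covers less than half, the remaining demand exceeds 1/2,
    and \<open>y\<close> meets it.\<close>
  moreover have "1 / 2 \<le> coverage I F y e" if "e \<in> E" for e
    using y(1) that by (fastforce simp: covering_feasible_def E_def)
  ultimately show "Y \<subseteq> I" "E \<subseteq> (\<Union>S\<in>Y. F S)" "sum (wII A) Y \<le> 2 * c * recourse I F (wII A) A v"
    using lp_based_set_cover_alg_half_covered[OF alg finite_index, of E "wII A" y F]
      wII_nonneg[OF A] y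
    unfolding Y_def by (auto simp: covering_feasible_def)
qed

text \<open>The first stage treats the half-covered elements of the whole of \<open>U\<close>, so it
  is the same for all scenarios. It is named explicitly, with only the second stage obtained, to
  make visible that it is determined by \<open>v\<close> without any recourse vector.\<close>

lemma rounding:
  assumes alg: "lp_based_set_cover_alg c alg" and v: "\<And>S. S \<in> I \<Longrightarrow> 0 \<le> v S"
    and ne: "\<And>A. A \<in> \<A> \<Longrightarrow> covering_feasible I F A (\<lambda>e. 1 - coverage I F v e) \<noteq> {}"
  defines "E \<equiv> {e\<in>U. 1 / 2 \<le> coverage I F v e}"
  defines "x \<equiv> (\<lambda>S. of_bool (S \<in> alg I (\<lambda>S. F S \<inter> E) E wI))"
  obtains y where "integer_solution I F \<A> x y"
    "\<And>A. A \<in> \<A> \<Longrightarrow> dot I (wII A) (y A) \<le> 2 * c * recourse I F (wII A) A v"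
    "integer_cost I \<A> p wI wII x y
       \<le> 2 * c * (dot I wI v + (\<Sum>A\<in>\<A>. pmf p A * recourse I F (wII A) A v))"
proof -
  define X where "X = alg I (\<lambda>S. F S \<inter> E) E wI"
  define L where "L A = {e\<in>A. coverage I F v e < 1 / 2}" for A
  define Y where "Y A = alg I (\<lambda>S. F S \<inter> L A) (L A) (wII A)" for A
  define y where "y = (\<lambda>A S. of_bool (S \<in> Y A) :: real)"
  have x_def': "x = (\<lambda>S. of_bool (S \<in> X))"
    by (simp add: x_def X_def)
  have "finite E"
    unfolding E_def using finite_universe by simp
  then have X: "X \<subseteq> I" "E \<subseteq> (\<Union>S\<in>X. F S)" "sum wI X \<le> 2 * c * dot I wI v"
    using lp_based_set_cover_alg_half_covered[where w = wI and y = v and E = E and F = F,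
        OF alg finite_index _ wI_nonneg v]
    unfolding X_def by (auto simp: E_def)
  have Y: "Y A \<subseteq> I" "L A \<subseteq> (\<Union>S\<in>Y A. F S)" "sum (wII A) (Y A) \<le> 2 * c * recourse I F (wII A) A v"
    if "A \<in> \<A>" for A
    using rounded_recourse[OF alg v that ne[OF that]] unfolding Y_def L_def by auto
  have dot_y: "dot I (wII A) (y A) \<le> 2 * c * recourse I F (wII A) A v" if "A \<in> \<A>" for A
    using Y[OF that] finite_index by (simp add: y_def dot_of_bool)
  have "\<exists>S\<in>I. e \<in> F S \<and> (x S = 1 \<or> y A S = 1)" if A: "A \<in> \<A>" "e \<in> A" for A e
  proof -
    have "e \<in> E \<or> e \<in> L A"
      using A scenario_subset by (auto simp: E_def L_def)
    then obtain S where "e \<in> F S" "S \<in> X \<or> S \<in> Y A"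
      using X(2) Y(2)[OF A(1)] by blast
    then show ?thesis using X(1) Y(1)[OF A(1)] by (auto simp: x_def' y_def)
  qed
  then have "integer_solution I F \<A> x y"
    by (auto simp: integer_solution_def x_def' y_def)
  moreover have "integer_cost I \<A> p wI wII x y
      \<le> 2 * c * (dot I wI v + (\<Sum>A\<in>\<A>. pmf p A * recourse I F (wII A) A v))"
  proof -
    have "(\<Sum>A\<in>\<A>. pmf p A * dot I (wII A) (y A))
        \<le> (\<Sum>A\<in>\<A>. pmf p A * (2 * c * recourse I F (wII A) A v))"
      using dot_y by (intro sum_mono mult_left_mono) auto
    also have "\<dots> = 2 * c * (\<Sum>A\<in>\<A>. pmf p A * recourse I F (wII A) A v)"
      by (simp add: sum_distrib_left mult_ac)
    finally show ?thesis
      using X finite_index by (simp add: integer_cost_def x_def' dot_of_bool distrib_left)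
  qed
  ultimately show thesis using that dot_y by blast
qed

end

theorem theorem1:
  fixes U :: "'a set" and I :: "'s set" and F :: "'s \<Rightarrow> 'a set"
    and \<A> :: "'a set set" and p :: "'a set pmf"
    and wI :: "'s \<Rightarrow> real" and wII :: "'a set \<Rightarrow> 's \<Rightarrow> real"
    and B \<rho> \<epsilon> :: real and x :: "'s \<Rightarrow> real"
  assumes "rasc_instance U I F \<A> p wI wII B \<rho>"
    and "0 < \<epsilon>"
  shows
    "(\<exists>x1. (\<forall>S\<in>I. 0 \<le> x1 S) \<and>
       (\<forall>y z r. rasc_feasible I F \<A> wII B x y z r \<longrightarrow>
          dot I wI x1 + (\<Sum>A\<in>\<A>. pmf p A * recourse I F (wII A) A x1)
            \<le> (1 + 1 / \<epsilon>) * rasc_objective I \<A> p wI wII x y z \<and>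
          measure_pmf.prob p {A\<in>\<A>. recourse I F (wII A) A x1 > (1 + 1 / \<epsilon>) * B}
            \<le> (1 + \<epsilon>) * (\<Sum>A\<in>\<A>. pmf p A * r A)))
     \<and>
     (\<forall>c (alg :: 's set \<Rightarrow> ('s \<Rightarrow> 'a set) \<Rightarrow> 'a set \<Rightarrow> ('s \<Rightarrow> real) \<Rightarrow> 's set).
       lp_based_set_cover_alg c alg \<longrightarrow>
       (\<exists>x2. \<forall>y z r. rasc_feasible I F \<A> wII B x y z r \<longrightarrow>
         (\<exists>y2. integer_solution I F \<A> x2 y2 \<and>
            integer_cost I \<A> p wI wII x2 y2
              \<le> 2 * c * (1 + 1 / \<epsilon>) * rasc_objective I \<A> p wI wII x y z \<and>
            measure_pmf.prob p {A\<in>\<A>. dot I (wII A) (y2 A) > 2 * c * B * (1 + 1 / \<epsilon>)}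
              \<le> (1 + \<epsilon>) * (\<Sum>A\<in>\<A>. pmf p A * r A))))"
proof -
  interpret rasc_instance U I F \<A> p wI wII B \<rho> by fact
  define k where "k = 1 + 1 / \<epsilon>"
  have k: "1 \<le> k" using \<open>0 < \<epsilon>\<close> by (simp add: k_def)
  \<comment> \<open>This vector is fixed before any \<open>y\<close>, \<open>z\<close>,
    \<open>r\<close> is considered, which is how both first stages come to depend on
    \<open>x\<close> alone.\<close>
  define v where "v = (\<lambda>S. k * x S)"
  show ?thesis
  proof (cases "\<forall>S\<in>I. 0 \<le> x S")
    case False
    then have "\<not> rasc_feasible I F \<A> wII B x y z r" for y z r
      by (auto simp: rasc_feasible_def)
    \<comment> \<open>With a negative entry in \<open>x\<close> nothing is feasible and the claims
      are vacuous, except that the fractional witness must still be nonnegative; the zero vector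
      is.\<close>
    then show ?thesis by (auto intro: exI[of _ "\<lambda>_. 0"])
  next
    case True
    then have v: "0 \<le> v S" if "S \<in> I" for S
      using that k by (simp add: v_def)
    have fractional: "dot I wI v + (\<Sum>A\<in>\<A>. pmf p A * recourse I F (wII A) A v)
          \<le> (1 + 1 / \<epsilon>) * rasc_objective I \<A> p wI wII x y z"
      and over_budget: "T \<subseteq> {A\<in>\<A>. recourse I F (wII A) A v > (1 + 1 / \<epsilon>) * B}
        \<Longrightarrow> measure_pmf.prob p T \<le> (1 + \<epsilon>) * (\<Sum>A\<in>\<A>. pmf p A * r A)"
      if "rasc_feasible I F \<A> wII B x y z r" for y z r T
      using scaled_expected_cost_le[OF that k] scaled_over_budget_prob_le[OF that \<open>0 < \<epsilon>\<close>]
      by (simp_all add: v_def k_def)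
    have "\<exists>x2. \<forall>y z r. rasc_feasible I F \<A> wII B x y z r \<longrightarrow>
         (\<exists>y2. integer_solution I F \<A> x2 y2 \<and>
            integer_cost I \<A> p wI wII x2 y2
              \<le> 2 * c * (1 + 1 / \<epsilon>) * rasc_objective I \<A> p wI wII x y z \<and>
            measure_pmf.prob p {A\<in>\<A>. dot I (wII A) (y2 A) > 2 * c * B * (1 + 1 / \<epsilon>)}
              \<le> (1 + \<epsilon>) * (\<Sum>A\<in>\<A>. pmf p A * r A))"
      if alg: "lp_based_set_cover_alg c alg"
      for c and alg :: "'s set \<Rightarrow> ('s \<Rightarrow> 'a set) \<Rightarrow> 'a set \<Rightarrow> ('s \<Rightarrow> real) \<Rightarrow> 's set"
    proof (rule exI, intro allI impI)
      fix y z r assume feas: "rasc_feasible I F \<A> wII B x y z r"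
      let ?E = "{e\<in>U. 1 / 2 \<le> coverage I F v e}"
      \<comment> \<open>The witness for the integer first stage; none of the fixed \<open>y\<close>,
        \<open>z\<close>, \<open>r\<close> occurs in it.\<close>
      let ?x = "\<lambda>S. of_bool (S \<in> alg I (\<lambda>S. F S \<inter> ?E) ?E wI)"
      have c: "0 \<le> c" using alg by (rule lp_based_set_cover_alg_nonneg_ratio)
      have ne: "covering_feasible I F A (\<lambda>e. 1 - coverage I F v e) \<noteq> {}" if "A \<in> \<A>" for A
        using recourse_feasible_total[OF feas k that] unfolding v_def by blast
      obtain y2 where y2: "integer_solution I F \<A> ?x y2"
        "\<And>A. A \<in> \<A> \<Longrightarrow> dot I (wII A) (y2 A) \<le> 2 * c * recourse I F (wII A) A v"
        "integer_cost I \<A> p wI wII ?x y2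
          \<le> 2 * c * (dot I wI v + (\<Sum>A\<in>\<A>. pmf p A * recourse I F (wII A) A v))"
        using rounding[OF alg v ne] by blast
      note y2(3)
      also have "2 * c * (dot I wI v + (\<Sum>A\<in>\<A>. pmf p A * recourse I F (wII A) A v))
          \<le> 2 * c * ((1 + 1 / \<epsilon>) * rasc_objective I \<A> p wI wII x y z)"
        using fractional[OF feas] c by (intro mult_left_mono) auto
      finally have cost: "integer_cost I \<A> p wI wII ?x y2
          \<le> 2 * c * (1 + 1 / \<epsilon>) * rasc_objective I \<A> p wI wII x y z"
        by (simp add: mult.assoc)
      \<comment> \<open>Rounding costs at most a factor \<open>2 * c\<close> in each scenario, so
        exceeding the enlarged budget forces the fractional recourse over its own bound.\<close>
      have "{A\<in>\<A>. dot I (wII A) (y2 A) > 2 * c * B * (1 + 1 / \<epsilon>)}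
          \<subseteq> {A\<in>\<A>. recourse I F (wII A) A v > (1 + 1 / \<epsilon>) * B}"
      proof safe
        fix A assume A: "A \<in> \<A>" "dot I (wII A) (y2 A) > 2 * c * B * (1 + 1 / \<epsilon>)"
        show "recourse I F (wII A) A v > (1 + 1 / \<epsilon>) * B"
        proof (rule ccontr)
          assume "\<not> ?thesis"
          then have "2 * c * recourse I F (wII A) A v \<le> 2 * c * ((1 + 1 / \<epsilon>) * B)"
            using c by (intro mult_left_mono) auto
          with y2(2)[OF A(1)] A(2) show False by (simp add: mult_ac)
        qed
      qed
      from over_budget[OF feas this] y2(1) cost
      show "\<exists>y2. integer_solution I F \<A> ?x y2 \<and>
            integer_cost I \<A> p wI wII ?x y2
              \<le> 2 * c * (1 + 1 / \<epsilon>) * rasc_objective I \<A> p wI wII x y z \<and>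
            measure_pmf.prob p {A\<in>\<A>. dot I (wII A) (y2 A) > 2 * c * B * (1 + 1 / \<epsilon>)}
              \<le> (1 + \<epsilon>) * (\<Sum>A\<in>\<A>. pmf p A * r A)"
        by blast
    qed
    moreover have "\<exists>x1. (\<forall>S\<in>I. 0 \<le> x1 S) \<and>
       (\<forall>y z r. rasc_feasible I F \<A> wII B x y z r \<longrightarrow>
          dot I wI x1 + (\<Sum>A\<in>\<A>. pmf p A * recourse I F (wII A) A x1)
            \<le> (1 + 1 / \<epsilon>) * rasc_objective I \<A> p wI wII x y z \<and>
          measure_pmf.prob p {A\<in>\<A>. recourse I F (wII A) A x1 > (1 + 1 / \<epsilon>) * B}
            \<le> (1 + \<epsilon>) * (\<Sum>A\<in>\<A>. pmf p A * r A))"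
      using v fractional over_budget[OF _ order_refl] by (intro exI[of _ v]) blast
    ultimately show ?thesis by blast
  qed
qed

end
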